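(* Let $S$ be a numerical semigroup such that $m(S)<F(S)+1$, and let $B=\{F(S)-f\mid f\in rPF(S)\}$. Assume that $\max B+1\le n(B)$ and $\max B+n(B)<2m(S)$. Then the following hold: (1) if $x\in[1,m(S)-1]\setminus B$, then $x\notin PF(S)$; (2) if $x\in B\setminus\{0\}$, then $x\notin PF(S)$. In particular, if $x\in[1,m(S)-1]$, then $x\notin PF(S)$.
   Context: $\mathbb{N}$ denotes the non-negative integers. For integers $x\le y$, $[x,y]=\{z\in\mathbb{Z}\mid x\le z\le y\}$. For sets of integers, $A+B=\{a+b\mid a\in A,b\in B\}$. A numerical semigroup is a submonoid $S$ of $(\mathbb{N},+)$ with $\mathbb{N}\setminus S$ finite. Its multiplicity $m(S)$ is the smallest element of $S\setminus\{0\}$; its Frobenius number $F(S)$ is the largest integer in $\mathbb{Z}\setminus S$. $PF(S)=\{x\in\mathbb{Z}\setminus S\mid x+s\in S\text{ for all }0\ne s\in S\}$, and $rPF(S)=[F(S)-m(S)+1,F(S)]\setminus S$. For a finite set $A\subset\mathbb{N}$ with $0\in A$, $n(A)$ is the integer such that $0,1,\dots,n(A)-1\in A+A$ and $n(A)\notin A+A$; if $0\notin A$, $n(A)=-1$. *)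

theory Defs
  imports Main "HOL-Library.Set_Algebras"
begin

text \<open>
  Everything lives in \<^typ>\<open>int\<close>, so that Frobenius numbers, pseudo-Frobenius numbers and
  gaps are compared without coercions; the non-negative integers are \<^term>\<open>{0::int..}\<close>, and
  the complement of a set \<open>S\<close> in the integers is \<open>- S\<close>. The sum of sets is the elementwise
  one from \<^theory>\<open>HOL-Library.Set_Algebras\<close>.
\<close>

definition numerical_semigroup :: "int set \<Rightarrow> bool" where
  "numerical_semigroup S \<longleftrightarrow>
     S \<subseteq> {0..} \<and> 0 \<in> S \<and> (\<forall>a\<in>S. \<forall>b\<in>S. a + b \<in> S) \<and> finite ({0..} - S)"

definition multiplicity_of :: "int set \<Rightarrow> int" where
  "multiplicity_of S = (LEAST s. s \<in> S - {0})"

definition frobenius_number :: "int set \<Rightarrow> int" where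
  "frobenius_number S = (GREATEST x. x \<in> - S)"

definition PF :: "int set \<Rightarrow> int set" where
  "PF S = {x \<in> - S. \<forall>s\<in>S. s \<noteq> 0 \<longrightarrow> x + s \<in> S}"

definition rPF :: "int set \<Rightarrow> int set" where
  "rPF S = {frobenius_number S - multiplicity_of S + 1..frobenius_number S} - S"

text \<open>
  The explicit \<open>0 \<le> n\<close> is needed for uniqueness: for negative \<open>n\<close> the interval
  \<open>{0..n - 1}\<close> is empty.
\<close>

definition sumset_bound :: "int set \<Rightarrow> int" where
  "sumset_bound A =
     (if 0 \<in> A then (THE n. 0 \<le> n \<and> {0..n - 1} \<subseteq> A + A \<and> n \<notin> A + A) else - 1)"

text \<open>The descriptions above denote the intended elements.\<close>

lemma multiplicity_of_smallest:
  assumes "numerical_semigroup S"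
  shows "multiplicity_of S \<in> S - {0} \<and> (\<forall>s\<in>S - {0}. multiplicity_of S \<le> s)"
proof -
  have "infinite {0::int..}"
    by (rule infinite_Ici)
  then have "infinite S"
    using assms unfolding numerical_semigroup_def
    by (metis finite_Diff2)
  then obtain t where t: "t \<in> S - {0}"
    by (metis finite.emptyI finite_insert finite_Diff_insert Diff_empty ex_in_conv)
  have nonneg: "0 \<le> s" if "s \<in> S" for s
    using assms that unfolding numerical_semigroup_def by auto
  define k where "k = (LEAST k. int k \<in> S - {0})"
  have "int (nat t) \<in> S - {0}"
    using t nonneg by auto
  then have k: "int k \<in> S - {0}"
    unfolding k_def by (rule LeastI)
  have le: "int k \<le> s" if s: "s \<in> S - {0}" for s
  proof -
    have "int (nat s) \<in> S - {0}"
      using s nonneg by auto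
    then have "k \<le> nat s"
      unfolding k_def by (rule Least_le)
    then show ?thesis
      using s nonneg[of s] by auto
  qed
  have "multiplicity_of S = int k"
    unfolding multiplicity_of_def using k le by (rule Least_equality)
  with k le show ?thesis
    by simp
qed

lemma frobenius_number_largest:
  assumes "numerical_semigroup S"
  shows "frobenius_number S \<in> - S \<and> (\<forall>x\<in>- S. x \<le> frobenius_number S)"
proof -
  define G where "G = insert (- 1) ({0..} - S)"
  have G: "finite G" "G \<noteq> {}" "G \<subseteq> - S"
    using assms unfolding G_def numerical_semigroup_def by auto
  have in_S: "Max G \<in> - S"
    using Max_in[OF G(1,2)] G(3) by blast
  have ge: "x \<le> Max G" if x: "x \<in> - S" for x
  proof (cases "0 \<le> x")
    case True
    then show ?thesis
      using x G(1) by (intro Max_ge) (auto simp: G_def)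
  next
    case False
    have "- 1 \<le> Max G"
      using G(1) by (intro Max_ge) (auto simp: G_def)
    with False show ?thesis
      by simp
  qed
  have "frobenius_number S = Max G"
    unfolding frobenius_number_def using in_S ge by (rule Greatest_equality)
  with in_S ge show ?thesis
    by simp
qed

lemma sumset_bound_characterization:
  assumes "finite A" "0 \<in> A"
  shows "0 \<le> sumset_bound A \<and> {0..sumset_bound A - 1} \<subseteq> A + A \<and> sumset_bound A \<notin> A + A"
proof -
  have fin: "finite (A + A)"
    using assms(1) by (simp add: finite_set_plus)
  have "\<exists>k. int k \<notin> A + A"
  proof (rule ccontr)
    assume "\<nexists>k. int k \<notin> A + A"
    then have "range int \<subseteq> A + A"
      by auto
    then have "finite (range int)"
      using fin finite_subset by blast
    then show False
      using finite_imageD[of int UNIV] by simp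
  qed
  then obtain j where j: "int j \<notin> A + A" ..
  define k where "k = (LEAST k. int k \<notin> A + A)"
  have k: "int k \<notin> A + A"
    unfolding k_def using j by (rule LeastI)
  have below: "{0..int k - 1} \<subseteq> A + A"
  proof
    fix x assume x: "x \<in> {0..int k - 1}"
    then have "nat x < k"
      by auto
    then have "\<not> int (nat x) \<notin> A + A"
      unfolding k_def by (rule not_less_Least)
    then show "x \<in> A + A"
      using x by simp
  qed
  let ?P = "\<lambda>n. 0 \<le> n \<and> {0..n - 1} \<subseteq> A + A \<and> n \<notin> A + A"
  have "\<exists>!n. ?P n"
  proof (rule ex1I)
    show "?P (int k)"
      using k below by simp
  next
    fix n assume n: "?P n"
    show "n = int k"
    proof (rule linorder_cases[of n "int k"])
      assume "n < int k"
      then have "n \<in> {0..int k - 1}" using n by simp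
      with below n show ?thesis by blast
    next
      assume "int k < n"
      then have "int k \<in> {0..n - 1}" by simp
      with k n show ?thesis by blast
    qed
  qed
  then have "?P (THE n. ?P n)"
    by (rule theI')
  then show ?thesis
    unfolding sumset_bound_def using assms(2) by simp
qed

end

(* Suppose x in B - {0} were pseudo-Frobenius. Then b \<in> B and b + x < m imply b + x \<in> B, since
   otherwise s = F - (b + x) is a nonzero element of S with x + s = F - b outside S.
   As 0 \<le> n - x < n, write n - x = b + b' with b, b' \<in> B. One of b + x, b' + x is below m,
   because their sum n + x is at most n + max B < 2m; hence n is in B + B, a contradiction. *)
theory Submission
  imports Defs
begin

theorem theorem1:
  fixes S B :: "int set"
  assumes "numerical_semigroup S"
    and "multiplicity_of S < frobenius_number S + 1"
    and "B = {frobenius_number S - f | f. f \<in> rPF S}"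
    and "Max B + 1 \<le> sumset_bound B"
    and "Max B + sumset_bound B < 2 * multiplicity_of S"
  shows "(\<forall>x \<in> {1..multiplicity_of S - 1} - B. x \<notin> PF S)
       \<and> (\<forall>x \<in> B - {0}. x \<notin> PF S)
       \<and> (\<forall>x \<in> {1..multiplicity_of S - 1}. x \<notin> PF S)"
proof -
  define m where "m = multiplicity_of S"
  define F where "F = frobenius_number S"
  define n where "n = sumset_bound B"
  have F: "F \<notin> S"
    using frobenius_number_largest[OF assms(1)] by (simp add: F_def)
  have "m \<in> S" "m \<noteq> 0"
    using multiplicity_of_smallest[OF assms(1)] by (simp_all add: m_def)
  then have m: "0 < m" "m \<le> F"
    using assms(1,2) unfolding numerical_semigroup_def m_def F_def by auto
  \<comment> \<open>Reflection in \<open>F\<close> turns the window of \<open>rPF S\<close> into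
    \<open>0 \<le> b < m\<close>; from here on only this membership test for \<open>B\<close> is
    used.\<close>
  have B_iff: "b \<in> B \<longleftrightarrow> 0 \<le> b \<and> b < m \<and> F - b \<notin> S" for b
  proof -
    have "b \<in> B \<longleftrightarrow> F - b \<in> rPF S"
    proof
      assume "F - b \<in> rPF S"
      moreover have "b = F - (F - b)"
        by simp
      ultimately show "b \<in> B"
        unfolding assms(3) F_def by blast
    qed (auto simp: assms(3) F_def)
    then show ?thesis
      by (auto simp: rPF_def m_def F_def)
  qed
  have "B \<subseteq> {0..<m}"
    by (auto simp: B_iff)
  then have "finite B"
    using finite_subset by blast
  \<comment> \<open>This rules out the default value -1 of \<open>sumset_bound\<close>.\<close>
  moreover have "0 \<in> B"
    using F m(1) by (simp add: B_iff)
  ultimately have n: "{0..n - 1} \<subseteq> B + B" "n \<notin> B + B"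
    using sumset_bound_characterization[of B] by (simp_all add: n_def)
  \<comment> \<open>Serves both claims: \<open>b = 0\<close> gives the first at once, and its
    contrapositive is the closure property \<open>shift\<close> behind the second.\<close>
  have not_PF: "x \<notin> PF S" if "b \<in> B" "0 \<le> b + x" "b + x < m" "b + x \<notin> B" for x b
  proof
    assume "x \<in> PF S"
    \<comment> \<open>Nonzero because \<open>b + x < m \<le> F\<close>; this is where the assumption
      on the multiplicity enters.\<close>
    moreover have "F - (b + x) \<in> S" "F - (b + x) \<noteq> 0"
      using that m(2) B_iff by auto
    ultimately have "x + (F - (b + x)) \<in> S"
      unfolding PF_def by blast
    then show False
      using \<open>b \<in> B\<close> B_iff by simp
  qed
  have 1: "x \<notin> PF S" if "x \<in> {1..m - 1} - B" for x
    using not_PF[OF \<open>0 \<in> B\<close>, of x] that by simp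
  have 2: "x \<notin> PF S" if x: "x \<in> B - {0}" for x
  proof
    assume PF: "x \<in> PF S"
    have "x \<le> Max B" and "0 < x"
      using x \<open>finite B\<close> B_iff[of x] by auto
    \<comment> \<open>Both bounds on \<open>Max B\<close> pass to \<open>x\<close>: the first keeps
      \<open>n - x\<close> nonnegative, the second gives \<open>lt\<close>.\<close>
    then have "n - x \<in> {0..n - 1}" and lt: "n + x < 2 * m"
      using assms(4,5) unfolding n_def m_def by auto
    then obtain b b' where b: "b \<in> B" "b' \<in> B" "n - x = b + b'"
      using n(1) by (meson set_plus_elim subsetD)
    have shift: "c + x \<in> B" if "c \<in> B" "c + x < m" for c
      using not_PF[of c x] that PF \<open>0 < x\<close> B_iff[of c] by auto
    consider "b + x < m" | "b' + x < m"
      using b(3) lt by linarith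
    then show False
    proof cases
      case 1
      then have "(b + x) + b' \<in> B + B"
        using shift b by (intro set_plus_intro)
      moreover have "(b + x) + b' = n"
        using b(3) by simp
      ultimately show False
        using n(2) by simp
    next
      case 2
      then have "b + (b' + x) \<in> B + B"
        using shift b by (intro set_plus_intro)
      moreover have "b + (b' + x) = n"
        using b(3) by simp
      ultimately show False
        using n(2) by simp
    qed
  qed
  have "x \<notin> PF S" if "x \<in> {1..m - 1}" for x
    using 1 2 that by (cases "x \<in> B") auto
  with 1 2 show ?thesis
    by (simp add: m_def)
qed

end
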